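(* Let $g:\mathbb{R}^n\to\mathbb{R}$ be $K$-Lipschitz with respect to the norm $\|\cdot\|_a$, i.e. $|g(\mathbf{x})-g(\mathbf{y})|\le K\|\mathbf{x}-\mathbf{y}\|_a$ for all $\mathbf{x},\mathbf{y}\in\mathbb{R}^n$. If $\mathbf{X}\in\mathcal{L}^p_n$ with $g(\mathbf{X})\in\mathcal{L}^p$, then for any $\epsilon\ge 0$, $$g\big(\mathcal{U}^n_\epsilon(\mathbf{X})\big)\subseteq \mathcal{U}_{K\epsilon}(g(\mathbf{X})).$$
   Context: Fix $a\ge 1$ and $p\ge 1$ and a non-atomic probability space $(\Omega,\mathcal{B},\mathbb{P})$ with $\mathcal{B}=\mathcal{B}(\mathbb{R}^n)$; all random variables/vectors live on it. $\|\mathbf{x}\|_a=(\sum_i|x_i|^a)^{1/a}$. $\mathcal{L}^p_n$ is the space of $n$-dimensional random vectors $\mathbf{X}$ with $\mathbb{E}[\|\mathbf{X}\|_a^p]<\infty$, and $\mathcal{L}^p=\mathcal{L}^p_1$. $F_{\mathbf{X}}$ is the cdf of $\mathbf{X}$. For cdfs $F,G$ on $\mathbb{R}^n$ with finite $p$-th moments, the Wasserstein distance is $W^n(F,G)=\inf (\mathbb{E}[\|\mathbf{X}-\mathbf{Y}\|_a^p])^{1/p}$, the infimum over all joint distributions (couplings) of $(\mathbf{X},\mathbf{Y})$ with $F_{\mathbf{X}}=F$, $F_{\mathbf{Y}}=G$; $W=W^1$. The Wasserstein uncertainty set is $\mathcal{U}^n_\epsilon(\mathbf{X})=\{\mathbf{Z}\in\mathcal{L}^p_n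 : W^n(F_{\mathbf{Z}},F_{\mathbf{X}})\le\epsilon\}$, with $\mathcal{U}_\epsilon=\mathcal{U}^1_\epsilon$ for univariate random variables. $g(\mathcal{U}^n_\epsilon(\mathbf{X}))=\{g(\mathbf{Z}):\mathbf{Z}\in\mathcal{U}^n_\epsilon(\mathbf{X})\}$. Standing assumption: the aggregation function $g$ is non-constant. *)

theory Defs
  imports "HOL-Probability.Probability"
begin

definition nonatomic :: "'w measure \<Rightarrow> bool" where
  "nonatomic M \<longleftrightarrow>
     (\<forall>A\<in>sets M. 0 < emeasure M A \<longrightarrow>
        (\<exists>B\<in>sets M. B \<subseteq> A \<and> 0 < emeasure M B \<and> emeasure M B < emeasure M A))"

text \<open>
  The following notions are stated over an arbitrary ordered Euclidean space, whose order is
  the coordinatewise one, so that \<^typ>\<open>real ^ 'n\<close> (random vectors) and \<^typ>\<open>real\<close>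
  (random variables) are both instances.
\<close>

definition anorm :: "real \<Rightarrow> 'a::euclidean_space \<Rightarrow> real" where
  "anorm a x = (\<Sum>b\<in>Basis. \<bar>x \<bullet> b\<bar> powr a) powr (1 / a)"

lemma anorm_vec: "anorm a (x :: real ^ 'n) = (\<Sum>i\<in>UNIV. \<bar>x $ i\<bar> powr a) powr (1 / a)"
proof -
  have B: "(Basis :: (real ^ 'n) set) = range (\<lambda>i. axis i 1)"
    by (auto simp: Basis_vec_def)
  have I: "inj (\<lambda>i::'n. axis i (1::real))"
    by (auto simp: inj_on_def axis_eq_axis)
  have "(\<Sum>b\<in>Basis. \<bar>x \<bullet> b\<bar> powr a) = (\<Sum>i\<in>UNIV. \<bar>x \<bullet> axis i 1\<bar> powr a)"
    unfolding B by (subst sum.reindex[OF I]) (simp add: o_def)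
  then show ?thesis
    by (simp add: anorm_def inner_axis)
qed

lemma anorm_real: "a \<noteq> 0 \<Longrightarrow> anorm a (x :: real) = \<bar>x\<bar>"
  by (simp add: anorm_def powr_powr)

definition rv_cdf :: "'w measure \<Rightarrow> ('w \<Rightarrow> 'a::ordered_euclidean_space) \<Rightarrow> 'a \<Rightarrow> real" where
  "rv_cdf M X = (\<lambda>x. measure M {\<omega> \<in> space M. X \<omega> \<le> x})"

lemma rv_cdf_vec:
  "rv_cdf M (X :: 'w \<Rightarrow> real ^ 'n) x = measure M {\<omega> \<in> space M. \<forall>i. X \<omega> $ i \<le> x $ i}"
  by (simp add: rv_cdf_def less_eq_vec_def)

definition Lp_space ::
  "'w measure \<Rightarrow> real \<Rightarrow> real \<Rightarrow> ('w \<Rightarrow> 'a::ordered_euclidean_space) set" where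
  "Lp_space M a p =
     {X \<in> borel_measurable M. integrable M (\<lambda>\<omega>. anorm a (X \<omega>) powr p)}"

definition couplings ::
  "('a::ordered_euclidean_space \<Rightarrow> real) \<Rightarrow> ('a \<Rightarrow> real) \<Rightarrow> ('a \<times> 'a) measure set" where
  "couplings F G =
     {\<pi>. prob_space \<pi> \<and> sets \<pi> = sets borel \<and> rv_cdf \<pi> fst = F \<and> rv_cdf \<pi> snd = G}"

text \<open>
  Meant for cdfs of probability laws with finite \<open>p\<close>-th moments: then couplings exist and the
  integrand is integrable for each of them, so neither the infimum of an empty set nor the
  default value 0 of the integral of a non-integrable function can occur.
\<close>

definition wasserstein ::
  "real \<Rightarrow> real \<Rightarrow> ('a::ordered_euclidean_space \<Rightarrow> real) \<Rightarrow> ('a \<Rightarrow> real) \<Rightarrow> real" where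
  "wasserstein a p F G =
     (INF \<pi>\<in>couplings F G. (\<integral>z. anorm a (fst z - snd z) powr p \<partial>\<pi>) powr (1 / p))"

definition uncertainty_set ::
  "'w measure \<Rightarrow> real \<Rightarrow> real \<Rightarrow> real \<Rightarrow> ('w \<Rightarrow> 'a::ordered_euclidean_space)
     \<Rightarrow> ('w \<Rightarrow> 'a) set" where
  "uncertainty_set M a p \<epsilon> X =
     {Z \<in> Lp_space M a p. wasserstein a p (rv_cdf M Z) (rv_cdf M X) \<le> \<epsilon>}"

end

(*
  A Lipschitz map pushes a coupling of Z and X forward to a coupling of g(Z) and g(X) whose
  transport cost is at most K times as large. The definition of a coupling prescribes only the
  marginal cdfs, so the uniqueness theorem for cdfs on Euclidean space is needed to know that the
  marginals are the laws of Z and X; it also yields the finiteness of the transport cost from that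
  of the p-th moments.
*)
theory Submission
  imports Defs
begin

section \<open>The norm\<close>

lemma anorm_nonneg [simp]: "0 \<le> anorm a x"
  by (simp add: anorm_def)

lemma anorm_0 [simp]: "anorm a 0 = 0"
  by (simp add: anorm_def)

text \<open>The real power \<open>powr\<close> is continuous at base 0 only for positive exponents,
  and \<open>0 < a\<close> makes both a and 1 / a positive.\<close>

lemma continuous_on_anorm: "0 < a \<Longrightarrow> continuous_on UNIV (anorm a)"
  unfolding anorm_def by (intro continuous_intros continuous_on_powr' ballI) (auto intro: sum_nonneg)

lemma borel_measurable_anorm [measurable]: "anorm a \<in> borel_measurable borel"
  unfolding anorm_def by measurable

lemma powr_max_le_add:
  fixes x y p :: real
  assumes "0 \<le> x" "0 \<le> y"
  shows "max x y powr p \<le> x powr p + y powr p"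
  using assms by (auto simp: max_def)

text \<open>A sum is at most twice its larger term. This argument also covers exponents below 1,
  where convexity fails: \<open>anorm_diff_le\<close> applies it to a and to 1 / a.\<close>

lemma powr_add_le:
  fixes x y p :: real
  assumes "0 \<le> x" "0 \<le> y" "0 \<le> p"
  shows "(x + y) powr p \<le> 2 powr p * (x powr p + y powr p)"
proof -
  have "(x + y) powr p \<le> (2 * max x y) powr p"
    using assms by (intro powr_mono2) auto
  also have "\<dots> = 2 powr p * max x y powr p"
    using assms by (simp add: powr_mult)
  also have "\<dots> \<le> 2 powr p * (x powr p + y powr p)"
    using powr_max_le_add[OF assms(1,2)] by (intro mult_left_mono) auto
  finally show ?thesis .
qed

text \<open>A crude substitute for Minkowski's inequality, which suffices for integrability.\<close>

lemma anorm_diff_le: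
  fixes x y :: "'a::euclidean_space"
  assumes "1 \<le> a"
  shows "anorm a (x - y) \<le> 4 * (anorm a x + anorm a y)"
proof -
  define S where "S z = (\<Sum>b\<in>Basis. \<bar>z \<bullet> b\<bar> powr a)" for z :: 'a
  have S_nonneg: "0 \<le> S z" for z
    unfolding S_def by (intro sum_nonneg) auto
  have S: "S z powr (1 / a) = anorm a z" for z
    by (simp add: S_def anorm_def)
  have "S (x - y) \<le> (\<Sum>b\<in>Basis. 2 powr a * (\<bar>x \<bullet> b\<bar> powr a + \<bar>y \<bullet> b\<bar> powr a))"
    unfolding S_def
  proof (intro sum_mono)
    fix b :: 'a
    have "\<bar>(x - y) \<bullet> b\<bar> powr a \<le> (\<bar>x \<bullet> b\<bar> + \<bar>y \<bullet> b\<bar>) powr a"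
      using assms by (intro powr_mono2) (auto simp: inner_diff_left)
    also have "\<dots> \<le> 2 powr a * (\<bar>x \<bullet> b\<bar> powr a + \<bar>y \<bullet> b\<bar> powr a)"
      using assms by (intro powr_add_le) auto
    finally show "\<bar>(x - y) \<bullet> b\<bar> powr a \<le> 2 powr a * (\<bar>x \<bullet> b\<bar> powr a + \<bar>y \<bullet> b\<bar> powr a)" .
  qed
  also have "\<dots> = 2 powr a * (S x + S y)"
    by (simp add: S_def sum_distrib_left sum.distrib distrib_left)
  finally have "S (x - y) powr (1 / a) \<le> (2 powr a * (S x + S y)) powr (1 / a)"
    using assms S_nonneg by (intro powr_mono2) auto
  also have "\<dots> = 2 * (S x + S y) powr (1 / a)"
    using assms S_nonneg by (simp add: powr_mult powr_powr)
  also have "\<dots> \<le> 2 * (2 powr (1 / a) * (S x powr (1 / a) + S y powr (1 / a)))"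
    using assms S_nonneg by (intro mult_left_mono powr_add_le) auto
  \<comment> \<open>Here the constant 4 is completed: one factor 2 came out of (2 powr a) powr (1 /
    a), and 2 powr (1 / a) \<le> 2 because 1 \<le> a.\<close>
  also have "\<dots> \<le> 2 * (2 powr 1 * (S x powr (1 / a) + S y powr (1 / a)))"
    using assms by (intro mult_left_mono mult_right_mono powr_mono) auto
  finally show ?thesis
    by (simp add: S)
qed

text \<open>Since \<open>anorm a\<close> is continuous and vanishes at 0, the Lipschitz bound
  squeezes g y - g x to 0. Continuity is what supplies the Borel measurability of g below.\<close>

lemma anorm_lipschitz_continuous:
  fixes g :: "'a::euclidean_space \<Rightarrow> real"
  assumes "0 < a" and lip: "\<And>x y. \<bar>g x - g y\<bar> \<le> K * anorm a (x - y)"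
  shows "continuous_on UNIV g"
proof -
  have "(g \<longlongrightarrow> g x) (at x)" for x
  proof (rule LIM_zero_cancel, rule Lim_null_comparison)
    show "\<forall>\<^sub>F y in at x. norm (g y - g x) \<le> K * anorm a (y - x)"
      using lip by simp
    have "continuous_on UNIV (\<lambda>y. K * anorm a (y - x))"
      by (rule continuous_on_mult_left, rule continuous_on_compose2[OF continuous_on_anorm[OF \<open>0 < a\<close>]])
        (auto intro: continuous_intros)
    then have "((\<lambda>y. K * anorm a (y - x)) \<longlongrightarrow> K * anorm a (x - x)) (at x)"
      unfolding continuous_on_def by blast
    then show "((\<lambda>y. K * anorm a (y - x)) \<longlongrightarrow> 0) (at x)"
      by simp
  qed
  then show ?thesis
    by (simp add: continuous_on_def)
qed

section \<open>Distribution functions determine laws\<close>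

text \<open>Lower orthants generate the Borel sets and are closed under intersection, because the
  coordinatewise order is a lattice order; a Dynkin system argument does the rest.\<close>

lemma prob_measure_eqI_atMost:
  fixes \<mu> \<nu> :: "'a::ordered_euclidean_space measure"
  assumes "prob_space \<mu>" "prob_space \<nu>" "sets \<mu> = sets borel" "sets \<nu> = sets borel"
    and eq: "\<And>x. measure \<mu> {..x} = measure \<nu> {..x}"
  shows "\<mu> = \<nu>"
proof -
  interpret \<mu>: prob_space \<mu> by fact
  interpret \<nu>: prob_space \<nu> by fact
  \<comment> \<open>The uniqueness rule asks for a countable cover by generators of finite measure;
    the orthants with corner (i, ..., i) exhaust the space.\<close>
  define A :: "nat \<Rightarrow> 'a set" where "A i = {..real i *\<^sub>R One}" for i
  have cover: "(\<Union>i. A i) = UNIV"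
  proof (intro set_eqI iffI UNIV_I)
    fix x :: 'a
    obtain n where n: "norm x \<le> real n"
      using real_arch_simple by blast
    have "x \<bullet> b \<le> real n" if "b \<in> Basis" for b
      using Basis_le_norm[OF that, of x] n by linarith
    then have "x \<in> A n"
      by (simp add: A_def eucl_le[where 'a = 'a])
    then show "x \<in> (\<Union>i. A i)" by blast
  qed
  show ?thesis
  proof (rule measure_eqI_generator_eq[where E = "range atMost" and \<Omega> = UNIV and A = A])
    have "{..x} \<inter> {..y} = {..inf x y}" for x y :: 'a
      by auto
    then show "Int_stable (range (atMost :: 'a \<Rightarrow> _))"
      by (auto simp: Int_stable_def)
    show "emeasure \<mu> B = emeasure \<nu> B" if "B \<in> range atMost" for B
      using that eq by (auto simp: \<mu>.emeasure_eq_measure \<nu>.emeasure_eq_measure)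
    show "sets \<mu> = sigma_sets UNIV (range atMost)" "sets \<nu> = sigma_sets UNIV (range atMost)"
      using assms(3,4) by (simp_all add: borel_eq_atMost)
  qed (auto simp: A_def cover[unfolded A_def])
qed

lemma rv_cdf_eq_measure_distr:
  fixes X :: "'w \<Rightarrow> 'a::ordered_euclidean_space"
  assumes [measurable]: "X \<in> borel_measurable M"
  shows "rv_cdf M X x = measure (distr M borel X) {..x}"
  by (subst measure_distr) (auto simp: rv_cdf_def vimage_def intro!: arg_cong[where f = "measure M"])

text \<open>Two base spaces are allowed, since a coordinate projection under a coupling is to be
  compared with a random vector on M.\<close>

lemma distr_eqI_rv_cdf:
  fixes X :: "'v \<Rightarrow> 'a::ordered_euclidean_space" and Y :: "'w \<Rightarrow> 'a"
  assumes "prob_space M" "prob_space N"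
    and "X \<in> borel_measurable M" "Y \<in> borel_measurable N" and "rv_cdf M X = rv_cdf N Y"
  shows "distr M borel X = distr N borel Y"
proof (rule prob_measure_eqI_atMost)
  show "measure (distr M borel X) {..x} = measure (distr N borel Y) {..x}" for x
    using assms(3-5) by (simp flip: rv_cdf_eq_measure_distr)
qed (use assms prob_space.prob_space_distr in auto)

text \<open>The preimage of an orthant under g need not be an orthant, so the hypothesis is equality
  of laws rather than of cdfs.\<close>

lemma rv_cdf_comp_cong:
  fixes X :: "'v \<Rightarrow> 'a::ordered_euclidean_space" and Y :: "'w \<Rightarrow> 'a"
    and g :: "'a \<Rightarrow> 'b::ordered_euclidean_space"
  assumes "distr M borel X = distr N borel Y"
    and [measurable]: "X \<in> borel_measurable M" "Y \<in> borel_measurable N" "g \<in> borel_measurable borel"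
  shows "rv_cdf M (\<lambda>\<omega>. g (X \<omega>)) = rv_cdf N (\<lambda>\<omega>. g (Y \<omega>))"
proof -
  have "distr M borel (\<lambda>\<omega>. g (X \<omega>)) = distr N borel (\<lambda>\<omega>. g (Y \<omega>))"
    using arg_cong[OF assms(1), of "\<lambda>\<mu>. distr \<mu> borel g"] by (simp add: distr_distr comp_def)
  then show ?thesis
    by (intro ext) (simp add: rv_cdf_eq_measure_distr)
qed

lemma integrable_comp_cong:
  fixes f :: "'a::topological_space \<Rightarrow> real"
  assumes "distr M borel X = distr N borel Y"
    and "X \<in> borel_measurable M" "Y \<in> borel_measurable N" "f \<in> borel_measurable borel"
  shows "integrable M (\<lambda>\<omega>. f (X \<omega>)) \<longleftrightarrow> integrable N (\<lambda>\<omega>. f (Y \<omega>))"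
  using assms by (metis integrable_distr_eq)

section \<open>Couplings\<close>

text \<open>By second countability, the Borel sets of the product are those of the product
  sigma-algebra, for which projections are measurable.\<close>

lemma measurable_coupling_projections:
  fixes \<pi> :: "('a::second_countable_topology \<times> 'a) measure"
  assumes "sets \<pi> = sets borel"
  shows "fst \<in> borel_measurable \<pi>" "snd \<in> borel_measurable \<pi>"
proof -
  have "sets \<pi> = sets (borel \<Otimes>\<^sub>M borel :: ('a \<times> 'a) measure)"
    using assms unfolding borel_prod .
  then show "fst \<in> borel_measurable \<pi>" "snd \<in> borel_measurable \<pi>"
    by (simp_all cong: measurable_cong_sets)
qed

text \<open>Serves twice: with the projections of a coupling composed with g it yields the
  pushed-forward coupling, and with Z and X on M it shows that couplings exist.\<close>

lemma distr_pair_in_couplings: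
  fixes X Y :: "'w \<Rightarrow> 'a::ordered_euclidean_space"
  assumes "prob_space M" and [measurable]: "X \<in> borel_measurable M" "Y \<in> borel_measurable M"
  shows "distr M borel (\<lambda>\<omega>. (X \<omega>, Y \<omega>)) \<in> couplings (rv_cdf M X) (rv_cdf M Y)"
proof -
  let ?\<pi> = "distr M borel (\<lambda>\<omega>. (X \<omega>, Y \<omega>))"
  note [measurable] = measurable_coupling_projections[OF refl]
  have "distr ?\<pi> borel fst = distr M borel X" "distr ?\<pi> borel snd = distr M borel Y"
    by (simp_all add: distr_distr comp_def)
  then have "rv_cdf ?\<pi> fst = rv_cdf M X" "rv_cdf ?\<pi> snd = rv_cdf M Y"
    by (auto simp: rv_cdf_eq_measure_distr)
  then show ?thesis
    using prob_space.prob_space_distr[OF assms(1), of "\<lambda>\<omega>. (X \<omega>, Y \<omega>)" borel]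
    by (simp add: couplings_def)
qed

text \<open>Costs are bounded below by 0, so the real infimum is a genuine lower bound.\<close>

lemma wasserstein_le_coupling:
  assumes "\<pi> \<in> couplings F G"
  shows "wasserstein a p F G \<le> (\<integral>z. anorm a (fst z - snd z) powr p \<partial>\<pi>) powr (1 / p)"
  unfolding wasserstein_def using assms by (intro cINF_lower bdd_belowI2[where m = 0]) auto

lemma couplings_distr:
  fixes X Z :: "'w \<Rightarrow> 'a::ordered_euclidean_space"
  assumes "prob_space M" "X \<in> borel_measurable M" "Z \<in> borel_measurable M"
    and "\<pi> \<in> couplings (rv_cdf M Z) (rv_cdf M X)"
  shows "distr \<pi> borel fst = distr M borel Z" "distr \<pi> borel snd = distr M borel X"
  using assms by (auto simp: couplings_def intro!: distr_eqI_rv_cdf measurable_coupling_projections)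

text \<open>The cost is dominated by the p-th moments of the marginals, which are those of Z and X.
  As a non-integrable function has integral 0 by convention, costs can be compared only once this is
  known.\<close>

lemma integrable_coupling_cost:
  fixes X Z :: "'w \<Rightarrow> 'a::ordered_euclidean_space"
  assumes "prob_space M" "1 \<le> a" "0 \<le> p" "X \<in> Lp_space M a p" "Z \<in> Lp_space M a p"
    and \<pi>: "\<pi> \<in> couplings (rv_cdf M Z) (rv_cdf M X)"
  shows "integrable \<pi> (\<lambda>z. anorm a (fst z - snd z) powr p)"
proof -
  have XZ: "X \<in> borel_measurable M" "Z \<in> borel_measurable M"
    and int: "integrable M (\<lambda>\<omega>. anorm a (X \<omega>) powr p)" "integrable M (\<lambda>\<omega>. anorm a (Z \<omega>) powr p)"
    using assms(4,5) by (auto simp: Lp_space_def)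
  have "sets \<pi> = sets borel"
    using \<pi> by (simp add: couplings_def)
  note [measurable] = measurable_coupling_projections[OF this]
  note distr = couplings_distr[OF assms(1) XZ \<pi>]
  have "integrable \<pi> (\<lambda>z. anorm a (fst z) powr p)" "integrable \<pi> (\<lambda>z. anorm a (snd z) powr p)"
    using int XZ integrable_comp_cong[OF distr(1), of "\<lambda>x. anorm a x powr p"]
      integrable_comp_cong[OF distr(2), of "\<lambda>x. anorm a x powr p"] by simp_all
  then have "integrable \<pi> (\<lambda>z. 4 powr p * (2 powr p *
      (anorm a (fst z) powr p + anorm a (snd z) powr p)))"
    by simp
  then show ?thesis
  proof (rule Bochner_Integration.integrable_bound)
    have "anorm a (x - y) powr p \<le> 4 powr p * (2 powr p * (anorm a x powr p + anorm a y powr p))"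
      for x y :: 'a
    proof -
      have "anorm a (x - y) powr p \<le> (4 * (anorm a x + anorm a y)) powr p"
        using anorm_diff_le[OF \<open>1 \<le> a\<close>] \<open>0 \<le> p\<close> by (intro powr_mono2) auto
      also have "\<dots> = 4 powr p * (anorm a x + anorm a y) powr p"
        by (simp add: powr_mult del: distrib_left_numeral)
      also have "\<dots> \<le> 4 powr p * (2 powr p * (anorm a x powr p + anorm a y powr p))"
        using \<open>0 \<le> p\<close> by (intro mult_left_mono powr_add_le) auto
      finally show ?thesis .
    qed
    then show "AE z in \<pi>. norm (anorm a (fst z - snd z) powr p) \<le>
        norm (4 powr p * (2 powr p * (anorm a (fst z) powr p + anorm a (snd z) powr p)))"
      by (simp add: abs_mult)
  qed measurable
qed

section \<open>Lipschitz images\<close>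

text \<open>The Lipschitz bound at 0 gives \<bar>g x\<bar> \<le> \<bar>g 0\<bar> + K *
  \<open>anorm a x\<close>, and constants are integrable on a probability space.\<close>

lemma lipschitz_comp_Lp_space:
  fixes g :: "'a::ordered_euclidean_space \<Rightarrow> real"
  assumes "prob_space M" "0 < a" "0 \<le> p" "0 \<le> K"
    and lip: "\<And>x y. \<bar>g x - g y\<bar> \<le> K * anorm a (x - y)"
    and Z: "Z \<in> Lp_space M a p"
  shows "g \<circ> Z \<in> Lp_space M a p"
proof -
  interpret prob_space M by fact
  have [measurable]: "g \<in> borel_measurable borel"
    using anorm_lipschitz_continuous[OF \<open>0 < a\<close> lip] by (rule borel_measurable_continuous_onI)
  have [measurable]: "Z \<in> borel_measurable M"
    and int: "integrable M (\<lambda>\<omega>. anorm a (Z \<omega>) powr p)"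
    using Z by (auto simp: Lp_space_def)
  have "integrable M (\<lambda>\<omega>. 2 powr p * (\<bar>g 0\<bar> powr p + K powr p * anorm a (Z \<omega>) powr p))"
    using int by simp
  then have "integrable M (\<lambda>\<omega>. \<bar>g (Z \<omega>)\<bar> powr p)"
  proof (rule Bochner_Integration.integrable_bound)
    have "\<bar>g x\<bar> powr p \<le> 2 powr p * (\<bar>g 0\<bar> powr p + K powr p * anorm a x powr p)" for x
    proof -
      have "\<bar>g x\<bar> powr p \<le> (\<bar>g 0\<bar> + K * anorm a x) powr p"
        using lip[of x 0] \<open>0 \<le> p\<close> by (intro powr_mono2) auto
      also have "\<dots> \<le> 2 powr p * (\<bar>g 0\<bar> powr p + (K * anorm a x) powr p)"
        using \<open>0 \<le> p\<close> \<open>0 \<le> K\<close> by (intro powr_add_le) auto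
      finally show ?thesis
        using \<open>0 \<le> K\<close> by (simp add: powr_mult)
    qed
    then show "AE \<omega> in M. norm (\<bar>g (Z \<omega>)\<bar> powr p) \<le>
        norm (2 powr p * (\<bar>g 0\<bar> powr p + K powr p * anorm a (Z \<omega>) powr p))"
      by (simp add: abs_mult)
  qed measurable
  then show ?thesis
    using \<open>0 < a\<close> by (simp add: Lp_space_def anorm_real)
qed

lemma wasserstein_lipschitz_comp_le:
  fixes g :: "'a::ordered_euclidean_space \<Rightarrow> real"
  assumes M: "prob_space M" and "1 \<le> a" "0 < p" "0 < K"
    and lip: "\<And>x y. \<bar>g x - g y\<bar> \<le> K * anorm a (x - y)"
    and X: "X \<in> Lp_space M a p" and Z: "Z \<in> Lp_space M a p"
  shows "wasserstein a p (rv_cdf M (g \<circ> Z)) (rv_cdf M (g \<circ> X))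
    \<le> K * wasserstein a p (rv_cdf M Z) (rv_cdf M X)"
proof -
  have [measurable]: "X \<in> borel_measurable M" "Z \<in> borel_measurable M"
    using X Z by (auto simp: Lp_space_def)
  have [measurable]: "g \<in> borel_measurable borel"
    using anorm_lipschitz_continuous[OF _ lip] \<open>1 \<le> a\<close>
    by (intro borel_measurable_continuous_onI) simp
  let ?W = "wasserstein a p (rv_cdf M (g \<circ> Z)) (rv_cdf M (g \<circ> X))"
  \<comment> \<open>Dividing by K makes the left side a lower bound for exactly the costs whose
    infimum is the distance between Z and X.\<close>
  have "?W / K \<le> (\<integral>z. anorm a (fst z - snd z) powr p \<partial>\<pi>) powr (1 / p)"
    if \<pi>: "\<pi> \<in> couplings (rv_cdf M Z) (rv_cdf M X)" for \<pi>
  proof -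
    have "prob_space \<pi>" "sets \<pi> = sets borel"
      using \<pi> by (auto simp: couplings_def)
    note [measurable] = measurable_coupling_projections[OF \<open>sets \<pi> = sets borel\<close>]
    have distr: "distr \<pi> borel fst = distr M borel Z" "distr \<pi> borel snd = distr M borel X"
      using couplings_distr[OF M _ _ \<pi>] by simp_all
    define \<rho> where "\<rho> = distr \<pi> borel (\<lambda>z. (g (fst z), g (snd z)))"
    have "\<rho> \<in> couplings (rv_cdf \<pi> (\<lambda>z. g (fst z))) (rv_cdf \<pi> (\<lambda>z. g (snd z)))"
      unfolding \<rho>_def using \<open>prob_space \<pi>\<close> by (intro distr_pair_in_couplings) measurable
    moreover have "rv_cdf \<pi> (\<lambda>z. g (fst z)) = rv_cdf M (g \<circ> Z)"
      unfolding comp_def by (rule rv_cdf_comp_cong[OF distr(1)]) measurable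
    moreover have "rv_cdf \<pi> (\<lambda>z. g (snd z)) = rv_cdf M (g \<circ> X)"
      unfolding comp_def by (rule rv_cdf_comp_cong[OF distr(2)]) measurable
    ultimately have "\<rho> \<in> couplings (rv_cdf M (g \<circ> Z)) (rv_cdf M (g \<circ> X))"
      by metis
    then have "?W \<le> (\<integral>z. anorm a (fst z - snd z) powr p \<partial>\<rho>) powr (1 / p)"
      by (rule wasserstein_le_coupling)
    also have "(\<integral>z. anorm a (fst z - snd z) powr p \<partial>\<rho>) powr (1 / p) =
        (\<integral>z. \<bar>g (fst z) - g (snd z)\<bar> powr p \<partial>\<pi>) powr (1 / p)"
      unfolding \<rho>_def using \<open>1 \<le> a\<close> measurable_coupling_projections[OF refl, where 'a = real]
      by (subst integral_distr) (auto simp: anorm_real)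
    \<comment> \<open>Monotonicity of the integral rests on integrability of the upper function,
      which the moment bound for couplings provides.\<close>
    also have "\<dots> \<le> (\<integral>z. K powr p * anorm a (fst z - snd z) powr p \<partial>\<pi>) powr (1 / p)"
    proof (intro powr_mono2 integral_mono_AE' AE_I2)
      show "integrable \<pi> (\<lambda>z. K powr p * anorm a (fst z - snd z) powr p)"
        using integrable_coupling_cost[OF M _ _ X Z \<pi>] \<open>1 \<le> a\<close> \<open>0 < p\<close> by simp
      show "\<bar>g (fst z) - g (snd z)\<bar> powr p \<le> K powr p * anorm a (fst z - snd z) powr p" for z
        using powr_mono2[OF _ _ lip, of p "fst z" "snd z"] \<open>0 < p\<close> \<open>0 < K\<close>
        by (simp add: powr_mult)
    qed (use \<open>0 < p\<close> in auto)
    also have "\<dots> = K * (\<integral>z. anorm a (fst z - snd z) powr p \<partial>\<pi>) powr (1 / p)"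
      using \<open>0 < p\<close> \<open>0 < K\<close> by (simp add: powr_mult powr_powr)
    finally have "?W \<le> K * (\<integral>z. anorm a (fst z - snd z) powr p \<partial>\<pi>) powr (1 / p)" .
    then show ?thesis
      using \<open>0 < K\<close> by (simp add: pos_divide_le_eq mult.commute)
  qed
  \<comment> \<open>A lower bound passes to a real infimum only over a nonempty set; the joint law
    of Z and X on M is a member.\<close>
  moreover have "couplings (rv_cdf M Z) (rv_cdf M X) \<noteq> {}"
    using distr_pair_in_couplings[OF M, of Z X] by auto
  ultimately have "?W / K \<le> wasserstein a p (rv_cdf M Z) (rv_cdf M X)"
    unfolding wasserstein_def[of a p "rv_cdf M Z"] by (intro cINF_greatest)
  then show ?thesis
    using \<open>0 < K\<close> by (simp add: field_simps)
qed

theorem theorem1: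
  fixes M :: "(real ^ 'n) measure"
    and a p K \<epsilon> :: real
    and g :: "real ^ 'n \<Rightarrow> real"
    and X :: "real ^ 'n \<Rightarrow> real ^ 'n"
  assumes "prob_space M" and "sets M = sets borel" and "nonatomic M"
    and "a \<ge> 1" and "p \<ge> 1"
    and "\<not> g constant_on UNIV"
    and "\<forall>x y. \<bar>g x - g y\<bar> \<le> K * anorm a (x - y)"
    and "X \<in> Lp_space M a p"
    and "g \<circ> X \<in> Lp_space M a p"
    and "\<epsilon> \<ge> 0"
  shows "(\<lambda>Z. g \<circ> Z) ` uncertainty_set M a p \<epsilon> X \<subseteq> uncertainty_set M a p (K * \<epsilon>) (g \<circ> X)"
proof (intro image_subsetI)
  fix Z assume "Z \<in> uncertainty_set M a p \<epsilon> X"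
  then have Z: "Z \<in> Lp_space M a p" and W: "wasserstein a p (rv_cdf M Z) (rv_cdf M X) \<le> \<epsilon>"
    by (auto simp: uncertainty_set_def)
  have lip: "\<bar>g x - g y\<bar> \<le> K * anorm a (x - y)" for x y
    using assms(7) by blast
  \<comment> \<open>The sign of K is extracted from non-constancy: two distinct values of g force K
    * \<open>anorm a (x - y)\<close> to be positive, hence K too.\<close>
  obtain x y where "g x \<noteq> g y"
    using assms(6) unfolding constant_on_def by blast
  then have "0 < K * anorm a (x - y)"
    using lip[of x y] by linarith
  then have "0 < K"
    using anorm_nonneg[of a "x - y"] by (simp add: zero_less_mult_iff)
  have "wasserstein a p (rv_cdf M (g \<circ> Z)) (rv_cdf M (g \<circ> X))
      \<le> K * wasserstein a p (rv_cdf M Z) (rv_cdf M X)"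
    using assms \<open>0 < K\<close> lip Z by (intro wasserstein_lipschitz_comp_le) auto
  also have "\<dots> \<le> K * \<epsilon>"
    using W \<open>0 < K\<close> by simp
  finally show "g \<circ> Z \<in> uncertainty_set M a p (K * \<epsilon>) (g \<circ> X)"
    using lipschitz_comp_Lp_space[OF assms(1) _ _ _ lip Z] assms(4,5) \<open>0 < K\<close>
    by (simp add: uncertainty_set_def)
qed

end
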